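(* Let $\mathcal{M}=\mathbb{R}^4$ with coordinates $(t,x^1,x^2,x^3)$, and let $\mathfrak{e}_3=\mathrm{span}(p_i,L_i : i=1,2,3)$ with $p_i=\partial_i$ and $L_i=\epsilon_{ijk}x^j\partial_k$. (1) A smooth real vector field $V$ on $\mathbb{R}^4$ satisfies $[V,\mathfrak{e}_3]\subseteq\mathfrak{e}_3$ if and only if it is of the form $$V=V^0(t)\,\partial_t+c^i\partial_i+d^iL_i+f\,x^i\partial_i$$ with $c^i,d^i,f\in\mathbb{R}$ and $V^0\in C^\infty(\mathbb{R})$. (2) Two vector fields $V_a=V_a^0(t)\partial_t+c_a^i\partial_i+d_a^iL_i+f_ax^i\partial_i$ and $V_b=V_b^0(t)\partial_t+c_b^i\partial_i+d_b^iL_i+f_bx^i\partial_i$ of this form commute if and only if $$d_a^id_b^j\epsilon_{ijk}=0\ \ \forall k,\qquad c_a^id_b^j\epsilon_{ijk}-c_b^id_a^j\epsilon_{ijk}+f_ac_b^k-f_bc_a^k=0\ \ \forall k,\qquad[V_a^0(t)\partial_t,V_b^0(t)\partial_t]=0.$$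
   Context: Repeated spatial indices are summed over $1,2,3$; $\epsilon_{ijk}$ is the Levi-Civita symbol; $\partial_i=\partial/\partial x^i$; $[\cdot,\cdot]$ is the Lie bracket of vector fields; spans are over $\mathbb{R}$. $\mathfrak{e}_3$ is the Lie algebra of the Euclidean group $E_3$ acting on the spatial coordinates (the symmetry of flat Friedmann-Robertson-Walker universes). *)

theory Defs
  imports "HOL-Analysis.Analysis" "HOL-Library.Function_Algebras"
begin

instantiation "fun" :: (type, real_vector) real_vector
begin

definition scaleR_fun_def: "r *\<^sub>R f = (\<lambda>x. r *\<^sub>R f x)"

instance
  by standard (simp_all add: scaleR_fun_def fun_eq_iff scaleR_add_right scaleR_add_left)

end

lemma scaleR_fun_apply [simp]: "(r *\<^sub>R f) x = r *\<^sub>R f x"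
  by (simp add: scaleR_fun_def)

text \<open>In finite dimension, \<open>Ck k\<close> is the usual class of k times continuously differentiable
  maps: every iterated directional derivative up to order k exists as a Frechet derivative,
  and those of order k are continuous.\<close>

primrec Ck :: "nat \<Rightarrow> ('a::real_normed_vector \<Rightarrow> 'b::real_normed_vector) \<Rightarrow> bool" where
  "Ck 0 f \<longleftrightarrow> continuous_on UNIV f"
| "Ck (Suc k) f \<longleftrightarrow> (\<forall>x. f differentiable (at x)) \<and>
     (\<forall>v. Ck k (\<lambda>x. frechet_derivative f (at x) v))"

definition smooth :: "('a::real_normed_vector \<Rightarrow> 'b::real_normed_vector) \<Rightarrow> bool" where
  "smooth f \<longleftrightarrow> (\<forall>k. Ck k f)"

text \<open>Spacetime \<open>(t, x\<^sup>1, x\<^sup>2, x\<^sup>3)\<close>. A vector field is represented by its components in the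
  coordinate frame, as a map from points to tangent vectors.\<close>

type_synonym spacetime = "real \<times> (real ^ 3)"

type_synonym vfield = "spacetime \<Rightarrow> spacetime"

text \<open>In components, \<open>[V, W]\<^sup>\<mu> = V\<^sup>\<nu> \<partial>\<^sub>\<nu> W\<^sup>\<mu> - W\<^sup>\<nu> \<partial>\<^sub>\<nu> V\<^sup>\<mu>\<close>.\<close>

definition lie_bracket :: "vfield \<Rightarrow> vfield \<Rightarrow> vfield" where
  "lie_bracket V W =
     (\<lambda>q. frechet_derivative W (at q) (V q) - frechet_derivative V (at q) (W q))"

definition levi_civita :: "3 \<Rightarrow> 3 \<Rightarrow> 3 \<Rightarrow> real" where
  "levi_civita i j k =
     (if (i, j, k) \<in> {(1, 2, 3), (2, 3, 1), (3, 1, 2)} then 1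
      else if (i, j, k) \<in> {(1, 3, 2), (2, 1, 3), (3, 2, 1)} then - 1
      else 0)"

definition del_t :: vfield where
  "del_t = (\<lambda>q. (1, 0))"

definition del :: "3 \<Rightarrow> vfield" where
  "del i = (\<lambda>q. (0, axis i 1))"

definition p_field :: "3 \<Rightarrow> vfield" where
  "p_field i = del i"

definition L_field :: "3 \<Rightarrow> vfield" where
  "L_field i = (\<lambda>(t, x). \<Sum>j\<in>UNIV. \<Sum>k\<in>UNIV. (levi_civita i j k * x $ j) *\<^sub>R del k (t, x))"

definition e3 :: "vfield set" where
  "e3 = span (range p_field \<union> range L_field)"

definition time_field :: "(real \<Rightarrow> real) \<Rightarrow> vfield" where
  "time_field V0 = (\<lambda>(t, x). V0 t *\<^sub>R del_t (t, x))"

definition dilation :: vfield where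
  "dilation = (\<lambda>(t, x). \<Sum>i\<in>UNIV. x $ i *\<^sub>R del i (t, x))"

definition normal_form :: "(real \<Rightarrow> real) \<Rightarrow> real ^ 3 \<Rightarrow> real ^ 3 \<Rightarrow> real \<Rightarrow> vfield" where
  "normal_form V0 c d f =
     time_field V0 + (\<Sum>i\<in>UNIV. c $ i *\<^sub>R del i) + (\<Sum>i\<in>UNIV. d $ i *\<^sub>R L_field i) + f *\<^sub>R dilation"

end

theory Submission
  imports Defs
begin

text \<open>In vector notation the normal form is \<open>(V\<^sup>0(t), c + d \<times> x + f x)\<close>, and \<open>e3\<close> consists of the
  fields \<open>(0, c + d \<times> x)\<close>; the Jacobi identity for the cross product makes the bracket of two
  normal forms again explicit, which settles (2) and one half of (1). Conversely, if \<open>V\<close> normalizes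
  \<open>e3\<close>, bracketing with the translations gives \<open>\<partial>\<^sub>i V = (0, a\<^sub>i + b\<^sub>i \<times> x)\<close>. Walking from \<open>0\<close> to
  \<open>e\<^sub>i + e\<^sub>j\<close> in either order forces \<open>b\<^sub>i \<times> e\<^sub>j = b\<^sub>j \<times> e\<^sub>i\<close>, hence \<open>b = 0\<close>, so that
  \<open>V = (V\<^sup>0(t), w(t) + A x)\<close>. Bracketing with the rotations shows that \<open>e\<^sub>i \<times> w(t)\<close> is constant in \<open>t\<close>
  and that the commutator of \<open>A\<close> with each infinitesimal rotation is antisymmetric, so that \<open>w\<close> is constant and
  \<open>A\<close> is antisymmetric plus scalar.\<close>

section \<open>Normal forms in cross-product notation\<close>

lemma sum_fun_apply: "(\<Sum>i\<in>A. f i) x = (\<Sum>i\<in>A. f i x)"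
  by (induction A rule: infinite_finite_induct) simp_all

lemma levi_civita_cross3:
  "(\<Sum>i\<in>UNIV. \<Sum>j\<in>UNIV. u $ i * v $ j * levi_civita i j k) = cross3 u v $ k"
  using exhaust_3[of k] by (auto simp: sum_3 levi_civita_def cross3_simps)

lemma L_field_apply: "L_field i (t, x) = (0, cross3 (axis i 1) x)"
  using exhaust_3[of i]
  by (auto simp: L_field_def del_def sum_3 levi_civita_def cross3_simps axis_def vec_eq_iff forall_3)

lemma normal_form_apply: "normal_form V0 c d f (t, x) = (V0 t, c + cross3 d x + f *\<^sub>R x)"
  by (simp add: normal_form_def sum_fun_apply time_field_def dilation_def L_field_apply
      del_def del_t_def sum_3 cross3_simps axis_def vec_eq_iff forall_3)

lemma normal_form_eq_iff:
  "normal_form A c d f = normal_form B c' d' f' \<longleftrightarrow> A = B \<and> c = c' \<and> d = d' \<and> f = f'"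
proof
  assume eq: "normal_form A c d f = normal_form B c' d' f'"
  have *: "(A t, c + cross3 d x + f *\<^sub>R x) = (B t, c' + cross3 d' x + f' *\<^sub>R x)" for t x
    using fun_cong[OF eq, of "(t, x)"] by (simp add: normal_form_apply)
  have "A = B" using * by auto
  moreover have c: "c = c'" using *[of _ 0] by simp
  moreover have lin: "cross3 d x + f *\<^sub>R x = cross3 d' x + f' *\<^sub>R x" for x
    using *[of _ x] c by simp
  \<comment> \<open>At e_1 the components of d x e_1 + f e_1 are f, d_3, -d_2; at e_2 the third one
    is d_1.\<close>
  have "d = d' \<and> f = f'"
    using lin[of "axis 1 1"] lin[of "axis 2 1"]
    by (simp add: cross3_simps axis_def vec_eq_iff forall_3)
  ultimately show "A = B \<and> c = c' \<and> d = d' \<and> f = f'" by simp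
qed simp

lemma p_field_normal_form: "p_field i = normal_form 0 (axis i 1) 0 0"
  by (auto simp: fun_eq_iff p_field_def del_def normal_form_apply)

lemma L_field_normal_form: "L_field i = normal_form 0 0 (axis i 1) 0"
  by (auto simp: fun_eq_iff L_field_apply normal_form_apply)

lemma time_field_normal_form: "time_field A = normal_form A 0 0 0"
  by (auto simp: fun_eq_iff time_field_def del_t_def normal_form_apply)

lemma normal_form_zero: "normal_form 0 0 0 0 = 0"
  by (auto simp: fun_eq_iff normal_form_apply zero_prod_def)

text \<open>Turns membership in the span into the existence of two vectors, the form in which the
  normalizer condition is exploited.\<close>

lemma e3_eq: "e3 = {normal_form 0 c d 0 | c d. True}"
proof
  have "subspace {normal_form 0 c d 0 | c d. True}"
  proof (rule subspaceI)
    show "0 \<in> {normal_form 0 c d 0 | c d. True}"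
      using normal_form_zero by (metis (mono_tags) mem_Collect_eq)
  next
    fix V W assume "V \<in> {normal_form 0 c d 0 | c d. True}" "W \<in> {normal_form 0 c d 0 | c d. True}"
    then obtain c d c' d' where "V = normal_form 0 c d 0" "W = normal_form 0 c' d' 0" by blast
    then have "V + W = normal_form 0 (c + c') (d + d') 0"
      by (auto simp: fun_eq_iff normal_form_apply cross_add_left)
    then show "V + W \<in> {normal_form 0 c d 0 | c d. True}" by blast
  next
    fix r V assume "V \<in> {normal_form 0 c d 0 | c d. True}"
    then obtain c d where "V = normal_form 0 c d 0" by blast
    then have "r *\<^sub>R V = normal_form 0 (r *\<^sub>R c) (r *\<^sub>R d) 0"
      by (auto simp: fun_eq_iff normal_form_apply cross_mult_left scaleR_add_right)
    then show "r *\<^sub>R V \<in> {normal_form 0 c d 0 | c d. True}" by blast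
  qed
  moreover have "range p_field \<union> range L_field \<subseteq> {normal_form 0 c d 0 | c d. True}"
    using p_field_normal_form L_field_normal_form by blast
  ultimately show "e3 \<subseteq> {normal_form 0 c d 0 | c d. True}"
    unfolding e3_def by (rule span_minimal[rotated])
next
  have "normal_form 0 c d 0 \<in> e3" for c d
  proof -
    have "normal_form 0 c d 0 = (\<Sum>i\<in>UNIV. c $ i *\<^sub>R p_field i) + (\<Sum>i\<in>UNIV. d $ i *\<^sub>R L_field i)"
      by (auto simp: normal_form_def p_field_def time_field_def fun_eq_iff)
    also have "\<dots> \<in> e3"
      unfolding e3_def by (intro span_add span_sum span_scale) (auto intro: span_base)
    finally show ?thesis .
  qed
  then show "{normal_form 0 c d 0 | c d. True} \<subseteq> e3" by blast
qed

section \<open>Derivatives and brackets of normal forms\<close>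

lemma bounded_linear_cross3_right: "bounded_linear (cross3 d)"
  by (simp add: bilinear_cross bilinear_conv_bounded_bilinear[symmetric]
      bounded_bilinear.bounded_linear_right)

lemma normal_form_has_derivative:
  assumes "(V0 has_real_derivative D) (at t)"
  shows "(normal_form V0 c d f has_derivative
           (\<lambda>h. (fst h * D, cross3 d (snd h) + f *\<^sub>R snd h))) (at (t, x))"
proof -
  have eq: "normal_form V0 c d f = (\<lambda>q. (V0 (fst q), c + cross3 d (snd q) + f *\<^sub>R snd q))"
    by (auto simp: fun_eq_iff normal_form_apply)
  have 1: "((\<lambda>q. V0 (fst q)) has_derivative (\<lambda>h. fst h * D)) (at (t, x))"
  proof -
    have "(V0 has_derivative (\<lambda>h. h * D)) (at (fst (t, x)))"
      using assms by (simp add: has_field_derivative_def mult.commute[of D] mult_commute_abs)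
    from has_derivative_compose[OF bounded_linear_imp_has_derivative[OF bounded_linear_fst] this]
    show ?thesis .
  qed
  have "bounded_linear (\<lambda>q :: spacetime. cross3 d (snd q) + f *\<^sub>R snd q)"
    by (intro bounded_linear_add bounded_linear_const_scaleR bounded_linear_snd
        bounded_linear_compose[OF bounded_linear_cross3_right])
  from has_derivative_add[OF has_derivative_const bounded_linear_imp_has_derivative[OF this]]
  have 2: "((\<lambda>q. c + cross3 d (snd q) + f *\<^sub>R snd q) has_derivative
      (\<lambda>h. cross3 d (snd h) + f *\<^sub>R snd h)) (at (t, x))"
    by (simp add: add.assoc)
  show ?thesis
    unfolding eq by (rule has_derivative_Pair[OF 1 2])
qed

lemma zero_has_real_derivative: "((0 :: real \<Rightarrow> real) has_real_derivative 0) (at t)"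
  by (simp add: zero_fun_def)

text \<open>The bracket of affine fields has as linear part minus the commutator of their matrices,
  whence the signs. Scalar matrices commute with everything and by Jacobi the commutator of two
  cross-product maps is again one, so no dilation survives.\<close>

lemma lie_bracket_normal_form:
  assumes "\<And>t. (A has_real_derivative A' t) (at t)" "\<And>t. (B has_real_derivative B' t) (at t)"
  shows "lie_bracket (normal_form A ca da fa) (normal_form B cb db fb) =
    normal_form (\<lambda>t. A t * B' t - B t * A' t)
      (- (cross3 ca db - cross3 cb da + fa *\<^sub>R cb - fb *\<^sub>R ca)) (- cross3 da db) 0"
proof -
  have "cross3 db (ca + cross3 da x + fa *\<^sub>R x) + fb *\<^sub>R (ca + cross3 da x + fa *\<^sub>R x)
     - (cross3 da (cb + cross3 db x + fb *\<^sub>R x) + fa *\<^sub>R (cb + cross3 db x + fb *\<^sub>R x))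
     = - (cross3 ca db - cross3 cb da + fa *\<^sub>R cb - fb *\<^sub>R ca) + cross3 (- cross3 da db) x" for x
    by (simp add: cross3_simps vec_eq_iff forall_3)
  then show ?thesis
    by (auto simp: fun_eq_iff lie_bracket_def normal_form_apply
        frechet_derivative_at[OF normal_form_has_derivative, OF assms(1), symmetric]
        frechet_derivative_at[OF normal_form_has_derivative, OF assms(2), symmetric])
qed

section \<open>Smoothness and integration along subspaces\<close>

lemma smooth_differentiable: "smooth f \<Longrightarrow> f differentiable (at x)"
  unfolding smooth_def by (metis Ck.simps(2))

lemma smooth_has_real_derivative:
  fixes f :: "real \<Rightarrow> real"
  assumes "smooth f"
  obtains f' where "\<And>t. (f has_real_derivative f' t) (at t)"
  using smooth_differentiable[OF assms] by (metis real_differentiable_def)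

text \<open>By the chain rule the derivative in direction v has the same shape, with f replaced by
  its derivative in direction M v, so the induction closes. It yields smoothness of the time
  coefficient, a component of V restricted to the time axis.\<close>

lemma Ck_linear_compose:
  assumes L: "bounded_linear L" and M: "bounded_linear M" and "Ck k f"
  shows "Ck k (\<lambda>x. L (f (M x)))"
  using \<open>Ck k f\<close>
proof (induction k arbitrary: f)
  case 0
  then have "continuous_on UNIV f" by simp
  then have "continuous_on UNIV (\<lambda>x. f (M x))"
    by (rule continuous_on_compose2) (simp_all add: linear_continuous_on[OF M])
  then show ?case
    by (simp add: bounded_linear.continuous_on[OF L])
next
  case (Suc k)
  have der: "((\<lambda>x. L (f (M x))) has_derivative
      (\<lambda>v. L (frechet_derivative f (at (M x)) (M v)))) (at x)" for x
  proof -
    have "(f has_derivative frechet_derivative f (at (M x))) (at (M x))"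
      using Suc.prems frechet_derivative_works by (metis Ck.simps(2))
    from has_derivative_compose[OF bounded_linear_imp_has_derivative[OF M] this]
    show ?thesis by (rule bounded_linear.has_derivative[OF L])
  qed
  have "Ck k (\<lambda>x. L (frechet_derivative f (at (M x)) (M v)))" for v
    using Suc.IH[of "\<lambda>x. frechet_derivative f (at x) (M v)"] Suc.prems by simp
  then show ?case
    by (simp add: frechet_derivative_at[OF der, symmetric] differentiableI[OF der])
qed

text \<open>Recovers V on p + range M from an antiderivative F: the difference has zero derivative
  everywhere. It is applied below to coordinate lines and to whole spatial slices.\<close>

lemma diff_const_along_subspace:
  fixes V :: "'a::real_normed_vector \<Rightarrow> 'b::real_normed_vector"
    and M :: "'c::real_normed_vector \<Rightarrow> 'a"
  assumes V: "\<And>q. V differentiable (at q)" and M: "bounded_linear M"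
    and F: "\<And>y. (F has_derivative F' y) (at y)"
    and eq: "\<And>y h. frechet_derivative V (at (p + M y)) (M h) = F' y h"
  shows "V (p + M y) - F y = V (p + M z) - F z"
proof -
  have "((\<lambda>y. V (p + M y) - F y) has_derivative (\<lambda>h. 0)) (at y)" for y
  proof -
    have "((\<lambda>y. p + M y) has_derivative M) (at y)"
      using has_derivative_add[OF has_derivative_const bounded_linear_imp_has_derivative[OF M]]
      by simp
    moreover have "(V has_derivative frechet_derivative V (at (p + M y))) (at (p + M y))"
      using V frechet_derivative_works by blast
    ultimately have "((\<lambda>y. V (p + M y)) has_derivative
        (\<lambda>h. frechet_derivative V (at (p + M y)) (M h))) (at y)"
      by (rule has_derivative_compose)
    from has_derivative_diff[OF this F] show ?thesis by (simp add: eq)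
  qed
  then obtain c where "\<And>y. V (p + M y) - F y = c"
    using has_derivative_zero_constant[of UNIV "\<lambda>y. V (p + M y) - F y"] by auto
  then show ?thesis by simp
qed

section \<open>Linear algebra in three dimensions\<close>

lemma axis_3_comps [simp]:
  "axis 1 (1::real) $ (1::3) = 1" "axis 1 (1::real) $ (2::3) = 0" "axis 1 (1::real) $ (3::3) = 0"
  "axis 2 (1::real) $ (1::3) = 0" "axis 2 (1::real) $ (2::3) = 1" "axis 2 (1::real) $ (3::3) = 0"
  "axis 3 (1::real) $ (1::3) = 0" "axis 3 (1::real) $ (2::3) = 0" "axis 3 (1::real) $ (3::3) = 1"
  by (simp_all add: axis_def)

text \<open>The array e_k . (b_j x e_i) is symmetric in i, j by assumption and antisymmetric in i,
  k, which forces it to vanish.\<close>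

lemma cross3_basis_symmetric_imp_zero:
  fixes b :: "3 \<Rightarrow> real ^ 3"
  assumes "\<And>i j. cross3 (b j) (axis i 1) = cross3 (b i) (axis j 1)"
  shows "b i = 0"
  using assms[of 1 2] assms[of 1 3] assms[of 2 3] exhaust_3[of i]
  by (auto simp: cross3_simps vec_eq_iff forall_3)

text \<open>The a_j are the columns of a matrix. Commutators with rotation generators preserve
  symmetry and antisymmetry, so its symmetric part commutes with all of them and is therefore
  scalar.\<close>

lemma rotation_commutators_imp_conformal:
  fixes a :: "3 \<Rightarrow> real ^ 3"
  assumes "\<And>i x. cross3 (axis i 1) (\<Sum>j\<in>UNIV. x $ j *\<^sub>R a j)
      - (\<Sum>j\<in>UNIV. cross3 (axis i 1) x $ j *\<^sub>R a j) = cross3 (d' i) x"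
  obtains d f where "\<And>x. (\<Sum>j\<in>UNIV. x $ j *\<^sub>R a j) = cross3 d x + f *\<^sub>R x"
proof -
  note h = assms[unfolded vec_eq_iff forall_3 sum_3 cross_components, simplified]
  have off: "a 1 $ 2 = - a 2 $ 1" "a 1 $ 3 = - a 3 $ 1" "a 2 $ 3 = - a 3 $ 2"
    and diag: "a 1 $ 1 = a 2 $ 2" "a 1 $ 1 = a 3 $ 3"
    using h[of 1 "axis 1 1"] h[of 1 "axis 2 1"] h[of 1 "axis 3 1"]
      h[of 2 "axis 1 1"] h[of 2 "axis 2 1"] h[of 2 "axis 3 1"]
      h[of 3 "axis 1 1"] h[of 3 "axis 2 1"] h[of 3 "axis 3 1"]
    by (simp_all add: cross_components)
  \<comment> \<open>The entries of d are read off from the off-diagonal part of a_j = d x e_j + f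
    e_j.\<close>
  have "(\<Sum>j\<in>UNIV. x $ j *\<^sub>R a j)
      = cross3 (vector [a 2 $ 3, a 3 $ 1, a 1 $ 2]) x + (a 1 $ 1) *\<^sub>R x" for x
    using off diag by (simp add: sum_3 vec_eq_iff forall_3 cross3_simps)
  then show ?thesis by (rule that)
qed

section \<open>The normalizer of \<open>e3\<close>\<close>

lemma e3_normalizer_imp_normal_form:
  fixes V :: vfield
  assumes "smooth V" and norm: "lie_bracket V ` e3 \<subseteq> e3"
  shows "\<exists>V0 c d f. smooth V0 \<and> V = normal_form V0 c d f"
proof -
  let ?D = "\<lambda>q. frechet_derivative V (at q)"
  note diff = smooth_differentiable[OF \<open>smooth V\<close>]
  define P where "P c d c' d' \<longleftrightarrow>
    (\<forall>t x. (0, cross3 d (snd (V (t, x)))) - ?D (t, x) (0, c + cross3 d x) = (0, c' + cross3 d' x))"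
    for c d c' d'
  have "\<exists>c' d'. P c d c' d'" for c d
  proof -
    have "lie_bracket V (normal_form 0 c d 0) \<in> e3"
      using norm e3_eq by blast
    then obtain c' d' where *: "lie_bracket V (normal_form 0 c d 0) = normal_form 0 c' d' 0"
      unfolding e3_eq by blast
    note D = frechet_derivative_at[OF normal_form_has_derivative[OF zero_has_real_derivative],
        symmetric]
    have "(0, cross3 d (snd (V (t, x)))) - ?D (t, x) (0, c + cross3 d x) = (0, c' + cross3 d' x)" for t x
      using fun_cong[OF *, of "(t, x)"] by (simp add: lie_bracket_def D normal_form_apply)
    then show ?thesis unfolding P_def by blast
  qed
  then obtain C B where "P c d (C c d) (B c d)" for c d
    by metis
  then have CB: "(0, cross3 d (snd (V (t, x)))) - ?D (t, x) (0, c + cross3 d x) = (0, C c d + cross3 (B c d) x)"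
    for c d t x
    unfolding P_def by blast
  \<comment> \<open>The bracket of V with p_i is minus the i-th partial derivative of V, hence the
    signs.\<close>
  define a where "a i = - C (axis i 1) 0" for i
  define b where "b i = - B (axis i 1) 0" for i
  have partial: "?D (t, x) (0, axis i 1) = (0, a i + cross3 (b i) x)" for t x i
    using CB[of 0 t x "axis i 1"] by (simp add: a_def b_def prod_eq_iff minus_equation_iff)
  have D_linear: "linear (?D q)" for q
    using diff frechet_derivative_works has_derivative_linear by blast
  have D_scale: "?D q (0, u *\<^sub>R v) = u *\<^sub>R ?D q (0, v)" for q u v
    using linear_scale[OF D_linear, of q u "(0, v)"] by simp
  have shift: "V (t, x + axis i 1) = V (t, x)
      + (0, a i + cross3 (b i) x + (1/2) *\<^sub>R cross3 (b i) (axis i 1))" for t x i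
  proof -
    \<comment> \<open>Antiderivative in u of a_i + b_i x (x + u e_i), the spatial part of the
      derivative along the line; at u = 1 its quadratic term gives the factor 1/2.\<close>
    define F where "F u = ((0::real),
      u *\<^sub>R (a i + cross3 (b i) x) + (u\<^sup>2 / 2) *\<^sub>R cross3 (b i) (axis i 1))" for u
    have "V ((t, x) + (0, 1 *\<^sub>R axis i 1)) - F 1 = V ((t, x) + (0, 0 *\<^sub>R axis i 1)) - F 0"
    proof (rule diff_const_along_subspace[where M = "\<lambda>u. (0, u *\<^sub>R axis i 1)"])
      show "(F has_derivative (\<lambda>h. (0, h *\<^sub>R (a i + cross3 (b i) x)
          + (h * u) *\<^sub>R cross3 (b i) (axis i 1)))) (at u)" for u
        unfolding F_def by (auto intro!: derivative_eq_intros)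
      show "bounded_linear (\<lambda>u::real. (0::real, u *\<^sub>R axis i (1::real) :: real^3))"
        by (intro bounded_linear_intros)
    qed (auto simp: diff D_scale partial cross_add_right cross_mult_right scaleR_add_right)
    then show ?thesis by (simp add: F_def algebra_simps flip: zero_prod_def)
  qed
  have "b i = 0" for i
  proof (rule cross3_basis_symmetric_imp_zero)
    fix i j
    \<comment> \<open>On both paths the a terms and the halved terms agree and cancel. This replaces
      the equality of mixed partial derivatives.\<close>
    have "V (0, axis i 1 + axis j 1) = V (0, axis j 1 + axis i 1)"
      by (simp add: add.commute)
    then show "cross3 (b j) (axis i 1) = cross3 (b i) (axis j 1)"
      using shift[of 0 0 i] shift[of 0 0 j] shift[of 0 "axis i 1" j] shift[of 0 "axis j 1" i]
      by (simp add: prod_eq_iff)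
  qed
  define A where "A x = (\<Sum>j\<in>UNIV. x $ j *\<^sub>R a j)" for x
  have D: "?D (t, x) (0, h) = (0, A h)" for t x h
  proof -
    have "(0::real, h) = (\<Sum>j\<in>UNIV. h $ j *\<^sub>R (0, axis j 1))"
      by (simp add: prod_eq_iff fst_sum snd_sum basis_expansion scalar_mult_eq_scaleR[symmetric])
    then have "?D (t, x) (0, h) = (\<Sum>j\<in>UNIV. h $ j *\<^sub>R ?D (t, x) (0, axis j 1))"
      by (simp only: linear_sum[OF D_linear] linear_scale[OF D_linear])
    then show ?thesis
      by (simp add: partial \<open>\<And>i. b i = 0\<close> A_def prod_eq_iff fst_sum snd_sum)
  qed
  have A0: "A 0 = 0" by (simp add: A_def)
  have A: "bounded_linear A"
    unfolding A_def by (intro bounded_linear_intros bounded_linear_vec_nth)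
  have affine: "V (t, x) = V (t, 0) + (0, A x)" for t x
  proof -
    have "V ((t, 0) + (0, x)) - (0, A x) = V ((t, 0) + (0, 0)) - (0, A 0)"
    proof (rule diff_const_along_subspace[where M = "\<lambda>x. (0, x)"])
      show "((\<lambda>x. (0, A x)) has_derivative (\<lambda>h. (0, A h))) (at x)" for x
        by (rule has_derivative_Pair[OF has_derivative_const bounded_linear_imp_has_derivative[OF A]])
      show "bounded_linear (\<lambda>x::real^3. (0::real, x))"
        by (intro bounded_linear_intros)
    qed (auto simp: diff D)
    then show ?thesis by (simp add: A0 algebra_simps flip: zero_prod_def)
  qed
  define w where "w t = snd (V (t, 0))" for t
  have rot: "cross3 (axis i 1) (w t + A x) - A (cross3 (axis i 1) x)
      = C 0 (axis i 1) + cross3 (B 0 (axis i 1)) x" for i t x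
    using CB[of "axis i 1" t x 0] affine[of t x] by (simp add: D w_def)
  have w_const: "w t = w 0" for t
  proof -
    have "cross3 (axis i 1) (w t) = cross3 (axis i 1) (w 0)" for i
      using rot[of i t 0] rot[of i 0 0] by (simp add: A0)
    \<comment> \<open>Two independent directions suffice: a vector is determined by its cross
      products with e_1 and e_2.\<close>
    from this[of 1] this[of 2] show ?thesis
      by (simp add: cross3_simps vec_eq_iff forall_3)
  qed
  \<comment> \<open>Subtracting the instance of \<open>rot\<close> at x = 0 removes w and the
    translation part.\<close>
  have "cross3 (axis i 1) (A x) - A (cross3 (axis i 1) x) = cross3 (B 0 (axis i 1)) x" for i x
    using rot[of i 0 x] rot[of i 0 0] by (simp add: A0 cross_add_right algebra_simps)
  from rotation_commutators_imp_conformal[OF this[unfolded A_def]]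
  obtain d f where df: "\<And>x. A x = cross3 d x + f *\<^sub>R x"
    unfolding A_def by blast
  define V0 where "V0 t = fst (V (t, 0))" for t
  have "smooth V0"
    unfolding smooth_def V0_def
  proof
    fix k
    have "bounded_linear (\<lambda>t::real. (t, 0::real^3))"
      by (intro bounded_linear_intros)
    then show "Ck k (\<lambda>t. fst (V (t, 0)))"
      using Ck_linear_compose[OF bounded_linear_fst, of "\<lambda>t. (t, 0)" k V] \<open>smooth V\<close>
      by (simp add: smooth_def)
  qed
  moreover have "V = normal_form V0 (w 0) d f"
  proof (rule ext, clarify)
    fix t x
    have "V (t, 0) = (V0 t, w 0)"
      using w_const[of t] by (simp add: V0_def w_def prod_eq_iff)
    then show "V (t, x) = normal_form V0 (w 0) d f (t, x)"
      using affine[of t x] by (simp add: normal_form_apply df add.assoc)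
  qed
  ultimately show ?thesis by blast
qed

lemma normal_form_imp_e3_normalizer:
  assumes "smooth V0"
  shows "lie_bracket (normal_form V0 c d f) ` e3 \<subseteq> e3"
proof -
  obtain V0' where "\<And>t. (V0 has_real_derivative V0' t) (at t)"
    using smooth_has_real_derivative[OF assms] by blast
  from lie_bracket_normal_form[OF this zero_has_real_derivative]
  have "lie_bracket (normal_form V0 c d f) (normal_form 0 c' d' 0) =
      normal_form 0 (- (cross3 c d' - cross3 c' d + f *\<^sub>R c' - 0 *\<^sub>R c)) (- cross3 d d') 0" for c' d'
    by (simp add: zero_fun_def)
  then show ?thesis by (auto simp: e3_eq)
qed

text \<open>The bracket is itself a normal form, so it vanishes exactly when each coefficient does;
  the bracket of the time fields is the special case c = d = f = 0.\<close>

lemma normal_forms_commute_iff: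
  assumes "smooth A" "smooth B"
  shows "lie_bracket (normal_form A ca da fa) (normal_form B cb db fb) = 0 \<longleftrightarrow>
    cross3 da db = 0 \<and> cross3 ca db - cross3 cb da + fa *\<^sub>R cb - fb *\<^sub>R ca = 0 \<and>
    lie_bracket (time_field A) (time_field B) = 0"
proof -
  obtain A' where A': "\<And>t. (A has_real_derivative A' t) (at t)"
    using smooth_has_real_derivative[OF assms(1)] by blast
  obtain B' where B': "\<And>t. (B has_real_derivative B' t) (at t)"
    using smooth_has_real_derivative[OF assms(2)] by blast
  show ?thesis
    unfolding time_field_normal_form lie_bracket_normal_form[OF A' B']
      normal_form_zero[symmetric] normal_form_eq_iff
    by (auto simp: neg_eq_iff_add_eq_0)
qed

theorem mainTheorem6:
  shows "(\<forall>V::vfield. smooth V \<longrightarrow>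
            (lie_bracket V ` e3 \<subseteq> e3 \<longleftrightarrow>
             (\<exists>(V0::real \<Rightarrow> real) (c::real^3) (d::real^3) (f::real).
                smooth V0 \<and> V = normal_form V0 c d f)))
       \<and> (\<forall>(V0a::real \<Rightarrow> real) (ca::real^3) (da::real^3) (fa::real)
            (V0b::real \<Rightarrow> real) (cb::real^3) (db::real^3) (fb::real).
            smooth V0a \<longrightarrow> smooth V0b \<longrightarrow>
            (lie_bracket (normal_form V0a ca da fa) (normal_form V0b cb db fb) = 0 \<longleftrightarrow>
             (\<forall>k. (\<Sum>i\<in>UNIV. \<Sum>j\<in>UNIV. da $ i * db $ j * levi_civita i j k) = 0) \<and>
             (\<forall>k. (\<Sum>i\<in>UNIV. \<Sum>j\<in>UNIV. ca $ i * db $ j * levi_civita i j k)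
                  - (\<Sum>i\<in>UNIV. \<Sum>j\<in>UNIV. cb $ i * da $ j * levi_civita i j k)
                  + fa * cb $ k - fb * ca $ k = 0) \<and>
             lie_bracket (time_field V0a) (time_field V0b) = 0))"
proof (intro conjI allI impI iffI)
  fix V :: vfield
  assume "smooth V" "lie_bracket V ` e3 \<subseteq> e3"
  then show "\<exists>V0 c d f. smooth V0 \<and> V = normal_form V0 c d f"
    by (rule e3_normalizer_imp_normal_form)
qed (auto simp: levi_civita_cross3 normal_forms_commute_iff vec_eq_iff
    dest: normal_form_imp_e3_normalizer)

end
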